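(* Let $(X,d)$ be a compact metric space and let $f_n: X\to X$ be continuous for each $n\geq 0$. Assume that there exist two sequences $\{A_n\}_{n=1}^\infty$ and $\{B_n\}_{n=1}^\infty$ of nonempty closed subsets of $X$ such that each of the two sequences consists of bounded sets, has the finite intersection property (every finite subfamily has nonempty intersection), and has diameters tending to zero, i.e. $d(A_n)\to0$ and $d(B_n)\to0$ as $n\to\infty$; such that $A_k\cap B_k=\emptyset$ for some $k\ge1$; and such that $$A_{n+1}\cup B_{n+1}\subset f_{n-1}(A_n)\cap f_{n-1}(B_n),\qquad n\ge1.$$ Then the system $x_{n+1}=f_n(x_n)$, $n\ge0$, is distributionally $\delta$-chaotic for some $\delta>0$.
   Context: For a set $A\subset X$, $d(A)$ denotes its diameter. For maps $f_n:X\to X$ ($n\ge0$), $f_0^0$ is the identity map on $X$ and $f_0^n:=f_{n-1}\circ\cdots\circ f_0$ for $n\ge1$. For $x,y\in X$ and $\epsilon>0$, set $$F^*_{x,y}(\epsilon)=\limsup_{n\to\infty}\frac1n\sum_{i=0}^{n-1}\chi_{[0,\epsilon)}\big(d(f_0^{i}(x),f_0^{i}(y))\big),\qquad F_{x,y}(\epsilon)=\liminf_{n\to\infty}\frac1n\sum_{i=0}^{n-1}\chi_{[0,\epsilon)}\big(d(f_0^{i}(x),f_0^{i}(y))\big),$$ where $\chi_{[0,\epsilon)}$ is the characteristic function of $[0,\epsilon)$. Let $\delta>0$. A set $D\subset X$ with at least two points is a distributionally $\delta$-scrambled set if for all $x,y\in D$ with $x\ne y$: $F^*_{x,y}(\epsilon)=1$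 for every $\epsilon>0$, and $F_{x,y}(\delta)=0$. The system is distributionally $\delta$-chaotic if it has an uncountable distributionally $\delta$-scrambled set. *)

theory Defs
  imports "HOL-Analysis.Analysis"
begin

primrec iterate :: "(nat \<Rightarrow> 'a \<Rightarrow> 'a) \<Rightarrow> nat \<Rightarrow> 'a \<Rightarrow> 'a" where
  "iterate f 0 = id"
| "iterate f (Suc n) = f n \<circ> iterate f n"

definition closeness_frequency ::
    "(nat \<Rightarrow> 'a::metric_space \<Rightarrow> 'a) \<Rightarrow> 'a \<Rightarrow> 'a \<Rightarrow> real \<Rightarrow> nat \<Rightarrow> real" where
  "closeness_frequency f x y \<epsilon> n =
     1 / real n * (\<Sum>i<n. indicator {0..<\<epsilon>} (dist (iterate f i x) (iterate f i y)))"

(* The frequencies lie in [0, 1]. They are embedded into the extended reals because limsup and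
   liminf are only available on complete lattices. *)

definition upper_distribution ::
    "(nat \<Rightarrow> 'a::metric_space \<Rightarrow> 'a) \<Rightarrow> 'a \<Rightarrow> 'a \<Rightarrow> real \<Rightarrow> ereal" where
  "upper_distribution f x y \<epsilon> = limsup (\<lambda>n. ereal (closeness_frequency f x y \<epsilon> n))"

definition lower_distribution ::
    "(nat \<Rightarrow> 'a::metric_space \<Rightarrow> 'a) \<Rightarrow> 'a \<Rightarrow> 'a \<Rightarrow> real \<Rightarrow> ereal" where
  "lower_distribution f x y \<epsilon> = liminf (\<lambda>n. ereal (closeness_frequency f x y \<epsilon> n))"

definition distributionally_scrambled ::
    "'a::metric_space set \<Rightarrow> (nat \<Rightarrow> 'a \<Rightarrow> 'a) \<Rightarrow> real \<Rightarrow> 'a set \<Rightarrow> bool" where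
  "distributionally_scrambled X f \<delta> D \<longleftrightarrow>
     D \<subseteq> X \<and> (\<exists>x\<in>D. \<exists>y\<in>D. x \<noteq> y) \<and>
     (\<forall>x\<in>D. \<forall>y\<in>D. x \<noteq> y \<longrightarrow>
        (\<forall>\<epsilon>>0. upper_distribution f x y \<epsilon> = 1) \<and> lower_distribution f x y \<delta> = 0)"

definition distributionally_chaotic ::
    "'a::metric_space set \<Rightarrow> (nat \<Rightarrow> 'a \<Rightarrow> 'a) \<Rightarrow> real \<Rightarrow> bool" where
  "distributionally_chaotic X f \<delta> \<longleftrightarrow>
     (\<exists>D. uncountable D \<and> distributionally_scrambled X f \<delta> D)"

(* Only the members with index at least 1 belong to the family. *)
definition finite_intersection_property :: "(nat \<Rightarrow> 'a set) \<Rightarrow> bool" where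
  "finite_intersection_property A \<longleftrightarrow>
     (\<forall>I. finite I \<and> I \<noteq> {} \<and> I \<subseteq> {1..} \<longrightarrow> (\<Inter>n\<in>I. A n) \<noteq> {})"

end

theory Submission
  imports Defs
begin

text \<open>
  The covering relation says that from either of \<open>A (n + 1)\<close>, \<open>B (n + 1)\<close> the map \<open>f n\<close> reaches
  all of both \<open>A (n + 2)\<close> and \<open>B (n + 2)\<close>. By compactness every itinerary, that is, every choice
  between \<open>A\<close> and \<open>B\<close> at each time, is therefore followed by the orbit of some point
  (\<open>itinerary_realized\<close>). The sets \<open>A n\<close> have a common point \<open>a\<close> and the sets \<open>B n\<close> a common
  point \<open>b\<close>, with \<open>a \<noteq> b\<close>. As the diameters tend to zero, late in time two orbits are
  arbitrarily close whenever their itineraries agree, and at least \<open>dist a b / 2\<close> apart whenever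
  the itineraries differ.

  It remains to find uncountably many itineraries such that any two of them agree, and also
  differ, at a set of times of upper density one. Positive times are cut into the blocks
  \<open>{fact m..<fact (Suc m)}\<close>, each so long that it makes up all but the fraction \<open>1 / (m + 1)\<close> of
  the times before its end. Itineraries are constant on blocks and are indexed by sets \<open>S\<close> of
  naturals: infinitely many blocks carry the letter \<open>B\<close> for every \<open>S\<close>, and for each \<open>j\<close>
  infinitely many blocks record whether \<open>j \<in> S\<close>. Two sets that differ at \<open>j\<close> thus give
  itineraries which agree on infinitely many whole blocks and differ on infinitely many others.
\<close>

section \<open>Orbits with a prescribed itinerary\<close>

lemma iterate_in:
  assumes "\<And>n. f n ` X \<subseteq> X" and "x \<in> X"
  shows "iterate f n x \<in> X"
  using assms by (induction n) auto

lemma continuous_on_iterate: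
  fixes X :: "'a::metric_space set"
  assumes "\<And>n. f n ` X \<subseteq> X" and "\<And>n. continuous_on X (f n)"
  shows "continuous_on X (iterate f n)"
proof (induction n)
  case 0
  show ?case by (simp add: id_def)
next
  case (Suc n)
  have "iterate f n ` X \<subseteq> X"
    using iterate_in[of f X] assms(1) by blast
  with Suc show ?case
    by (simp only: iterate.simps)
       (meson assms(2) continuous_on_compose continuous_on_subset)
qed

text \<open>
  A finite itinerary can be traced backwards from any point of its last set, because each set is
  covered by the image of the previous one.
\<close>

lemma finite_itinerary_realized:
  assumes "\<And>n. C n \<subseteq> X" and "\<And>n. C (Suc n) \<subseteq> f n ` C n" and "y \<in> C n"
  shows "\<exists>x\<in>X. (\<forall>i\<le>n. iterate f i x \<in> C i) \<and> iterate f n x = y"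
  using assms(3)
proof (induction n arbitrary: y)
  case 0
  then show ?case using assms(1) by auto
next
  case (Suc n)
  then obtain z where z: "z \<in> C n" "y = f n z"
    using assms(2) by blast
  with Suc.IH obtain x where "x \<in> X" "\<forall>i\<le>n. iterate f i x \<in> C i" "iterate f n x = z"
    by blast
  with z Suc.prems show ?case
    by (intro bexI[of _ x]) (auto simp: le_Suc_eq)
qed

text \<open>
  The points that follow the itinerary at one given time form a closed set, and by the finite case
  finitely many of these sets always meet; compactness passes to all times at once.
\<close>

lemma itinerary_realized:
  fixes X :: "'a::metric_space set"
  assumes "compact X" and "\<And>n. f n ` X \<subseteq> X" and "\<And>n. continuous_on X (f n)"
    and closed: "\<And>n. closedin (top_of_set X) (C n)" and nonempty: "\<And>n. C n \<noteq> {}"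
    and cover: "\<And>n. C (Suc n) \<subseteq> f n ` C n"
  shows "\<exists>x\<in>X. \<forall>n. iterate f n x \<in> C n"
proof -
  have sub: "C n \<subseteq> X" for n
    using closed closedin_imp_subset by blast
  have "X \<inter> (\<Inter>n. X \<inter> iterate f n -` C n) \<noteq> {}"
  proof (rule compact_imp_fip_image[OF \<open>compact X\<close>])
    fix n
    have "closed X" "closed (C n)"
      using \<open>compact X\<close> closed[of n] by (auto simp: compact_imp_closed closedin_closed_eq)
    then show "closed (X \<inter> iterate f n -` C n)"
      using continuous_on_iterate[of f X n, OF assms(2,3)]
      by (simp add: continuous_on_closed_vimage Int_commute)
  next
    fix I :: "nat set"
    assume "finite I"
    then obtain k where k: "\<forall>i\<in>I. i \<le> k"
      using finite_nat_set_iff_bounded_le by auto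
    obtain y where "y \<in> C k"
      using nonempty by blast
    from finite_itinerary_realized[where C = C, OF sub cover this] k
    show "X \<inter> (\<Inter>n\<in>I. X \<inter> iterate f n -` C n) \<noteq> {}"
      by blast
  qed
  then show ?thesis by blast
qed

lemma finite_intersection_property_common_point:
  fixes X :: "'a::metric_space set"
  assumes "compact X" and closed: "\<And>n. n \<ge> 1 \<Longrightarrow> closedin (top_of_set X) (A n)"
    and "finite_intersection_property A"
  shows "\<exists>a. \<forall>n\<ge>1. a \<in> A n"
proof -
  have "X \<inter> (\<Inter>n\<in>{1..}. A n) \<noteq> {}"
  proof (rule compact_imp_fip_image[OF \<open>compact X\<close>])
    fix n :: nat
    assume "n \<in> {1..}"
    then show "closed (A n)"
      using closed[of n] \<open>compact X\<close> by (auto simp: compact_imp_closed closedin_closed_eq)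
  next
    fix I :: "nat set"
    assume I: "finite I" "I \<subseteq> {1..}"
    \<comment> \<open>Adjoining the index 1 makes the subfamily nonempty and places its intersection inside \<open>X\<close>.\<close>
    then have "(\<Inter>n\<in>insert 1 I. A n) \<noteq> {}"
      using assms(3) by (auto simp: finite_intersection_property_def)
    moreover have "A 1 \<subseteq> X"
      using closed[of 1] closedin_imp_subset by auto
    ultimately show "X \<inter> (\<Inter>n\<in>I. A n) \<noteq> {}"
      by auto
  qed
  then show ?thesis by auto
qed

section \<open>Averages over long blocks\<close>

lemma fact_divide_fact_Suc: "real (fact m) / real (fact (Suc m)) = 1 / real (Suc m)"
proof -
  have "real (fact (Suc m)) = real (Suc m) * real (fact m)"
    by (simp only: fact_Suc of_nat_mult of_nat_id)
  then show ?thesis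
    by (simp del: of_nat_Suc fact_Suc of_nat_fact)
qed

text \<open>
  The block \<open>{fact m..<fact (Suc m)}\<close> fills the fraction \<open>1 - 1 / (m + 1)\<close> of the times before
  its end, so that what happens during the block dominates the average taken there.
\<close>

lemma closeness_frequency_block_close:
  assumes "\<And>i. i \<in> {fact m..<fact (Suc m)} \<Longrightarrow> dist (iterate f i x) (iterate f i y) < \<epsilon>"
  shows "closeness_frequency f x y \<epsilon> (fact (Suc m)) \<ge> 1 - 1 / real (Suc m)"
proof -
  define u :: "nat \<Rightarrow> real"
    where "u i = indicator {0..<\<epsilon>} (dist (iterate f i x) (iterate f i y))" for i
  have "real (fact (Suc m)) - real (fact m) = (\<Sum>i\<in>{fact m..<fact (Suc m) :: nat}. 1)"
    using fact_mono_nat[of m "Suc m"] by (simp add: of_nat_diff del: fact_Suc)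
  also have "\<dots> = (\<Sum>i\<in>{fact m..<fact (Suc m)}. u i)"
    using assms by (intro sum.cong) (auto simp: u_def)
  also have "\<dots> \<le> (\<Sum>i<fact (Suc m). u i)"
    by (intro sum_mono2) (auto simp: u_def)
  finally have "(real (fact (Suc m)) - real (fact m)) / real (fact (Suc m)) \<le>
      (\<Sum>i<fact (Suc m). u i) / real (fact (Suc m))"
    by (intro divide_right_mono) auto
  moreover have "(real (fact (Suc m)) - real (fact m)) / real (fact (Suc m)) = 1 - 1 / real (Suc m)"
    using fact_divide_fact_Suc[of m] by (simp add: diff_divide_distrib del: of_nat_Suc fact_Suc)
  ultimately show ?thesis
    by (simp add: closeness_frequency_def u_def)
qed

lemma closeness_frequency_block_apart:
  assumes "\<And>i. i \<in> {fact m..<fact (Suc m)} \<Longrightarrow> dist (iterate f i x) (iterate f i y) \<ge> \<epsilon>"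
  shows "closeness_frequency f x y \<epsilon> (fact (Suc m)) \<le> 1 / real (Suc m)"
proof -
  define u :: "nat \<Rightarrow> real"
    where "u i = indicator {0..<\<epsilon>} (dist (iterate f i x) (iterate f i y))" for i
  have "(\<Sum>i<fact (Suc m). u i) = (\<Sum>i<fact m. u i)"
  proof (rule sum.mono_neutral_right)
    show "{..<fact m} \<subseteq> {..<fact (Suc m) :: nat}"
      using fact_mono[of m "Suc m", where 'a = nat] by auto
    show "\<forall>i\<in>{..<fact (Suc m)} - {..<fact m}. u i = 0"
    proof
      fix i :: nat
      assume "i \<in> {..<fact (Suc m)} - {..<fact m}"
      then show "u i = 0"
        using assms[of i] by (simp add: u_def)
    qed
  qed simp
  also have "\<dots> \<le> (\<Sum>i\<in>{..<fact m :: nat}. 1 :: real)"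
    by (intro sum_mono) (auto simp: u_def indicator_def)
  finally have "(\<Sum>i<fact (Suc m). u i) / real (fact (Suc m)) \<le> real (fact m) / real (fact (Suc m))"
    by (intro divide_right_mono) auto
  moreover have "real (fact m) / real (fact (Suc m)) = 1 / real (Suc m)"
    by (rule fact_divide_fact_Suc)
  ultimately show ?thesis
    by (simp add: closeness_frequency_def u_def)
qed

lemma closeness_frequency_bounds:
  "0 \<le> closeness_frequency f x y \<epsilon> n" "closeness_frequency f x y \<epsilon> n \<le> 1"
proof -
  show "0 \<le> closeness_frequency f x y \<epsilon> n"
    by (auto simp: closeness_frequency_def intro!: divide_nonneg_nonneg sum_nonneg)
  have "(\<Sum>i<n. indicator {0..<\<epsilon>} (dist (iterate f i x) (iterate f i y))) \<le> (\<Sum>i<n. 1 :: real)"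
    by (intro sum_mono) (auto simp: indicator_def)
  then show "closeness_frequency f x y \<epsilon> n \<le> 1"
    by (cases "n = 0") (auto simp: closeness_frequency_def divide_le_eq)
qed

lemma filterlim_fact_Suc: "filterlim (\<lambda>m. fact (Suc m) :: nat) sequentially sequentially"
  by (rule filterlim_at_top_mono[OF filterlim_ident])
     (intro always_eventually allI order_trans[OF _ fact_ge_self], simp)

lemma upper_distribution_eq_1:
  assumes "\<exists>\<^sub>F m in sequentially. \<forall>i\<in>{fact m..<fact (Suc m)}.
             dist (iterate f i x) (iterate f i y) < \<epsilon>"
  shows "upper_distribution f x y \<epsilon> = 1"
proof (rule antisym)
  show "upper_distribution f x y \<epsilon> \<le> 1"
    unfolding upper_distribution_def
    by (rule Limsup_bounded) (simp add: closeness_frequency_bounds one_ereal_def)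
  show "1 \<le> upper_distribution f x y \<epsilon>"
  proof (rule ccontr)
    assume "\<not> ?thesis"
    then obtain r where r: "upper_distribution f x y \<epsilon> < ereal r" "ereal r < 1"
      using ereal_dense2 by (meson not_le)
    then have "\<forall>\<^sub>F n in sequentially. closeness_frequency f x y \<epsilon> n < r"
      unfolding upper_distribution_def by (auto dest: Limsup_lessD)
    then have "\<forall>\<^sub>F m in sequentially. closeness_frequency f x y \<epsilon> (fact (Suc m)) < r"
      using filterlim_fact_Suc by (auto simp: filterlim_iff)
    moreover have "\<forall>\<^sub>F m in sequentially. r < 1 - 1 / real (Suc m)"
    proof (rule order_tendstoD(1)[where y = 1])
      show "(\<lambda>m. 1 - 1 / real (Suc m)) \<longlonglongrightarrow> 1"
        using tendsto_diff[OF tendsto_const LIMSEQ_inverse_real_of_nat, of "1::real"]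
        by (simp add: field_simps)
      show "r < 1" using r(2) by (simp add: one_ereal_def)
    qed
    ultimately have "\<forall>\<^sub>F m in sequentially. \<not> (\<forall>i\<in>{fact m..<fact (Suc m)}.
        dist (iterate f i x) (iterate f i y) < \<epsilon>)"
    proof eventually_elim
      case (elim m)
      then show ?case
        using closeness_frequency_block_close[where m = m and \<epsilon> = \<epsilon> and f = f and x = x and y = y] by force
    qed
    with assms show False
      by (simp add: frequently_def)
  qed
qed

lemma lower_distribution_eq_0:
  assumes "\<exists>\<^sub>F m in sequentially. \<forall>i\<in>{fact m..<fact (Suc m)}.
             dist (iterate f i x) (iterate f i y) \<ge> \<epsilon>"
  shows "lower_distribution f x y \<epsilon> = 0"
proof (rule antisym)
  show "0 \<le> lower_distribution f x y \<epsilon>"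
    unfolding lower_distribution_def
    by (rule Liminf_bounded) (simp add: closeness_frequency_bounds)
  show "lower_distribution f x y \<epsilon> \<le> 0"
  proof (rule ccontr)
    assume "\<not> ?thesis"
    then obtain r where r: "0 < ereal r" "ereal r < lower_distribution f x y \<epsilon>"
      using ereal_dense2 by (meson not_le)
    then have "\<forall>\<^sub>F n in sequentially. r < closeness_frequency f x y \<epsilon> n"
      unfolding lower_distribution_def by (auto dest: less_LiminfD)
    then have "\<forall>\<^sub>F m in sequentially. r < closeness_frequency f x y \<epsilon> (fact (Suc m))"
      using filterlim_fact_Suc by (auto simp: filterlim_iff)
    moreover have "\<forall>\<^sub>F m in sequentially. 1 / real (Suc m) < r"
    proof (rule order_tendstoD(2)[where y = 0])
      show "(\<lambda>m. 1 / real (Suc m)) \<longlonglongrightarrow> 0"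
        using LIMSEQ_inverse_real_of_nat by (simp add: field_simps)
      show "0 < r" using r(1) by simp
    qed
    ultimately have "\<forall>\<^sub>F m in sequentially. \<not> (\<forall>i\<in>{fact m..<fact (Suc m)}.
        dist (iterate f i x) (iterate f i y) \<ge> \<epsilon>)"
    proof eventually_elim
      case (elim m)
      then show ?case
        using closeness_frequency_block_apart[where m = m and \<epsilon> = \<epsilon> and f = f and x = x and y = y] by force
    qed
    with assms show False
      by (simp add: frequently_def)
  qed
qed

section \<open>Uncountably many itineraries\<close>

text \<open>
  The first component of \<open>prod_decode m\<close> takes every value infinitely often. The value 0 is
  reserved for blocks on which all codes agree, and the value \<open>Suc j\<close> marks the blocks that record
  membership of \<open>j\<close>.
\<close>

definition block_letter :: "nat set \<Rightarrow> nat \<Rightarrow> bool" where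
  "block_letter S m = (case fst (prod_decode m) of 0 \<Rightarrow> False | Suc j \<Rightarrow> j \<in> S)"

definition code :: "nat set \<Rightarrow> nat \<Rightarrow> bool" where
  "code S n \<longleftrightarrow> (\<exists>m. n \<in> {fact m..<fact (Suc m)} \<and> block_letter S m)"

lemma factorial_block_unique:
  fixes n :: nat
  assumes "n \<in> {fact m..<fact (Suc m)}" and "n \<in> {fact k..<fact (Suc k)}"
  shows "m = k"
proof (rule ccontr)
  assume "m \<noteq> k"
  then have "(fact (Suc m) :: nat) \<le> fact k \<or> (fact (Suc k) :: nat) \<le> fact m"
    using fact_mono_nat by (metis Suc_leI nat_neq_iff)
  with assms show False by auto
qed

lemma code_eq_block_letter:
  "n \<in> {fact m..<fact (Suc m)} \<Longrightarrow> code S n = block_letter S m"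
  unfolding code_def using factorial_block_unique by blast

lemma frequently_prod_decode: "\<exists>\<^sub>F m in sequentially. fst (prod_decode m) = j"
  unfolding frequently_sequentially
proof
  fix N
  show "\<exists>m\<ge>N. fst (prod_decode m) = j"
    by (rule exI[of _ "prod_encode (j, N)"]) (simp add: le_prod_encode_2)
qed

lemma code_frequently_agree:
  "\<exists>\<^sub>F m in sequentially. \<forall>n\<in>{fact m..<fact (Suc m)}. code S n = code T n"
  using frequently_prod_decode[of 0]
  by (rule frequently_elim1) (auto simp: code_eq_block_letter block_letter_def simp del: fact_Suc)

lemma code_frequently_differ:
  assumes "S \<noteq> T"
  shows "\<exists>\<^sub>F m in sequentially. \<forall>n\<in>{fact m..<fact (Suc m)}. code S n \<noteq> code T n"
proof -
  obtain j where "j \<in> S \<longleftrightarrow> j \<notin> T"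
    using assms by blast
  then show ?thesis
    using frequently_prod_decode[of "Suc j"]
    by (elim frequently_elim1) (auto simp: code_eq_block_letter block_letter_def simp del: fact_Suc)
qed

lemma uncountable_UNIV_nat_set: "uncountable (UNIV :: nat set set)"
  using Cantors_theorem[of "UNIV :: nat set"] by (auto simp: uncountable_def)

section \<open>Distributional chaos\<close>

lemma eventually_on_factorial_blocks:
  assumes "\<forall>\<^sub>F n in sequentially. P n"
  shows "\<forall>\<^sub>F m in sequentially. \<forall>n\<in>{fact m..<fact (Suc m)}. P n"
proof -
  obtain N where N: "\<And>n. n \<ge> N \<Longrightarrow> P n"
    using assms by (auto simp: eventually_sequentially)
  have "P n" if "m \<ge> N" "n \<in> {fact m..<fact (Suc m)}" for m n
    using that fact_ge_self[of m] by (intro N) (auto simp del: fact_Suc)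
  then show ?thesis
    unfolding eventually_sequentially by blast
qed

theorem theorem4p6:
  fixes X :: "'a::metric_space set"
    and f :: "nat \<Rightarrow> 'a \<Rightarrow> 'a"
    and A B :: "nat \<Rightarrow> 'a set"
  assumes "compact X"
    and "\<And>n. f n ` X \<subseteq> X"
    and "\<And>n. continuous_on X (f n)"
    and "\<And>n. n \<ge> 1 \<Longrightarrow> A n \<noteq> {} \<and> closedin (top_of_set X) (A n) \<and> bounded (A n)"
    and "\<And>n. n \<ge> 1 \<Longrightarrow> B n \<noteq> {} \<and> closedin (top_of_set X) (B n) \<and> bounded (B n)"
    and "finite_intersection_property A"
    and "finite_intersection_property B"
    and "(\<lambda>n. diameter (A n)) \<longlonglongrightarrow> 0"
    and "(\<lambda>n. diameter (B n)) \<longlonglongrightarrow> 0"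
    and "\<exists>k\<ge>1. A k \<inter> B k = {}"
    and "\<And>n. n \<ge> 1 \<Longrightarrow> A (n + 1) \<union> B (n + 1) \<subseteq> f (n - 1) ` A n \<inter> f (n - 1) ` B n"
  shows "\<exists>\<delta>>0. distributionally_chaotic X f \<delta>"
proof -
  obtain a where a: "\<And>n. n \<ge> 1 \<Longrightarrow> a \<in> A n"
    using finite_intersection_property_common_point[of X A] assms(1,4,6) by blast
  obtain b where b: "\<And>n. n \<ge> 1 \<Longrightarrow> b \<in> B n"
    using finite_intersection_property_common_point[of X B] assms(1,5,7) by blast
  have "a \<noteq> b"
    using assms(10) a b by blast
  define \<delta> where "\<delta> = dist a b / 2"
  have "\<delta> > 0"
    using \<open>a \<noteq> b\<close> by (simp add: \<delta>_def)

  \<comment> \<open>Time starts at 0 but the families at 1, whence the shift of the index.\<close>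
  define C where "C S n = (if code S n then A (Suc n) else B (Suc n))" for S n
  have "\<exists>x\<in>X. \<forall>n. iterate f n x \<in> C S n" for S
  proof (rule itinerary_realized[OF assms(1-3)])
    fix n
    show "closedin (top_of_set X) (C S n)" "C S n \<noteq> {}"
      using assms(4,5)[of "Suc n"] by (auto simp: C_def)
    show "C S (Suc n) \<subseteq> f n ` C S n"
      using assms(11)[of "Suc n"] by (auto simp: C_def)
  qed
  then obtain x where xX: "\<And>S. x S \<in> X" and xC: "\<And>S n. iterate f n (x S) \<in> C S n"
    by metis

  have small: "\<forall>\<^sub>F n in sequentially. diameter (A (Suc n)) < r \<and> diameter (B (Suc n)) < r"
    if "r > 0" for r
    using order_tendstoD(2)[OF LIMSEQ_Suc[OF assms(8)] that]
      order_tendstoD(2)[OF LIMSEQ_Suc[OF assms(9)] that] by (rule eventually_conj)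
  have close: "\<forall>\<^sub>F n in sequentially. code S n = code T n \<longrightarrow>
      dist (iterate f n (x S)) (iterate f n (x T)) < r" if "r > 0" for r S T
    using small[OF that]
  proof eventually_elim
    case (elim n)
    have "dist (iterate f n (x S)) (iterate f n (x T)) \<le> diameter (C S n)"
      if "code S n = code T n"
      using xC[of n S] xC[of n T] that assms(4,5)[of "Suc n"]
      by (intro diameter_bounded_bound) (auto simp: C_def)
    with elim show ?case
      by (fastforce simp: C_def split: if_splits)
  qed
  \<comment> \<open>As \<open>dist a b = 2 * \<delta>\<close>, it suffices that each of the two diameters is at most \<open>\<delta> / 2\<close>.\<close>
  have AB: "\<forall>\<^sub>F n in sequentially. \<forall>p\<in>A (Suc n). \<forall>q\<in>B (Suc n). \<delta> \<le> dist p q"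
    using small[of "\<delta> / 2"] \<open>\<delta> > 0\<close>
  proof (simp, elim eventually_mono, intro ballI)
    fix n p q
    assume n: "diameter (A (Suc n)) * 2 < \<delta> \<and> diameter (B (Suc n)) * 2 < \<delta>"
      and p: "p \<in> A (Suc n)" and q: "q \<in> B (Suc n)"
    have "dist a p \<le> diameter (A (Suc n))"
      using a[of "Suc n"] p assms(4)[of "Suc n"] by (intro diameter_bounded_bound) auto
    moreover have "dist q b \<le> diameter (B (Suc n))"
      using b[of "Suc n"] q assms(5)[of "Suc n"] by (intro diameter_bounded_bound) auto
    moreover have "dist a b \<le> dist a p + dist p q + dist q b"
      by metric
    ultimately show "\<delta> \<le> dist p q"
      using n by (simp add: \<delta>_def)
  qed
  have apart: "\<forall>\<^sub>F n in sequentially. code S n \<noteq> code T n \<longrightarrow>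
      \<delta> \<le> dist (iterate f n (x S)) (iterate f n (x T))" for S T
    using AB
  proof eventually_elim
    case (elim n)
    then show ?case
      using xC[of n S] xC[of n T]
      by (cases "code S n"; cases "code T n") (auto simp: C_def dist_commute)
  qed

  have upper: "upper_distribution f (x S) (x T) \<epsilon> = 1" if "\<epsilon> > 0" for S T \<epsilon>
    using frequently_eventually_frequently[OF code_frequently_agree[of S T]
        eventually_on_factorial_blocks[OF close[OF that, of S T]]]
    by (intro upper_distribution_eq_1) (elim frequently_elim1, blast)
  have lower: "lower_distribution f (x S) (x T) \<delta> = 0" if "S \<noteq> T" for S T
    using frequently_eventually_frequently[OF code_frequently_differ[OF that]
        eventually_on_factorial_blocks[OF apart[of S T]]]
    by (intro lower_distribution_eq_0) (elim frequently_elim1, blast)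

  have "inj x"
  proof (rule injI, rule ccontr)
    fix S T
    assume "x S = x T" "S \<noteq> T"
    \<comment> \<open>A point is always close to itself, so that its lower distribution with itself is 1.\<close>
    then have "lower_distribution f (x S) (x S) \<delta> = 0"
      using lower[of S T] by simp
    moreover have "1 \<le> lower_distribution f (x S) (x S) \<delta>"
      unfolding lower_distribution_def
    proof (rule Liminf_bounded, rule eventually_sequentiallyI[of 1])
      fix n :: nat
      assume "1 \<le> n"
      then show "1 \<le> ereal (closeness_frequency f (x S) (x S) \<delta> n)"
        using \<open>\<delta> > 0\<close> by (simp add: closeness_frequency_def one_ereal_def)
    qed
    ultimately show False by simp
  qed
  then have "uncountable (range x)"
    using uncountable_UNIV_nat_set by (simp add: countable_image_inj_eq)
  moreover have "distributionally_scrambled X f \<delta> (range x)"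
    unfolding distributionally_scrambled_def
  proof (intro conjI)
    show "range x \<subseteq> X"
      using xX by blast
    have "x {} \<noteq> x UNIV"
      using \<open>inj x\<close> by (simp add: inj_eq)
    then show "\<exists>p\<in>range x. \<exists>q\<in>range x. p \<noteq> q"
      by blast
  next
    show "\<forall>p\<in>range x. \<forall>q\<in>range x. p \<noteq> q \<longrightarrow>
        (\<forall>\<epsilon>>0. upper_distribution f p q \<epsilon> = 1) \<and> lower_distribution f p q \<delta> = 0"
    proof (clarify, intro conjI allI impI)
      fix S T \<epsilon>
      assume "x S \<noteq> x T"
      then show "lower_distribution f (x S) (x T) \<delta> = 0"
        by (intro lower) auto
    qed (rule upper)
  qed
  ultimately show ?thesis
    using \<open>\<delta> > 0\<close> unfolding distributionally_chaotic_def by blast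
qed

end
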